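(* Let $A, B, C, X \in \mathbb{R}^{n\times n}$. If $B$ is nonsingular, then the T-congruence Sylvester equation $AX + X^{\mathrm T}B = C$ can be transformed into the Lyapunov equation of the form $$\hat X - \hat M\hat X \hat M^{\mathrm T} = \hat Q,$$ where $\hat X := X^{\mathrm T}B$, $\hat M := A(B^{\mathrm T})^{-1}$, and $\hat Q := C - \mathrm{vec}^{-1}\bigl(P_{nn}\,\mathrm{vec}(C\hat M^{\mathrm T})\bigr)$.
   Context: In the T-congruence Sylvester equation $AX + X^{\mathrm T}B = C$ the matrices $A,B,C$ are given and $X$ is to be determined; $X^{\mathrm T}$ denotes the transpose of $X$. For a matrix $Y\in\mathbb{R}^{n\times n}$ with columns $y_1,\dots,y_n$, $\mathrm{vec}(Y)\in\mathbb{R}^{n^2}$ is the vector obtained by stacking $y_1,\dots,y_n$ on top of each other in this order, and $\mathrm{vec}^{-1}:\mathbb{R}^{n^2}\to\mathbb{R}^{n\times n}$ is the inverse operator, so $\mathrm{vec}^{-1}(\mathrm{vec}(Y))=Y$. Let $e_{in}\in\mathbb{R}^n$ be the column vector with $1$ in position $i$ and $0$ elsewhere, $I_n$ the $n\times n$ identity matrix, and $\otimes$ the Kronecker (tensor) product. $P_{nn}\in\mathbb{R}^{n^2\times n^2}$ is the permutation matrix obtained by stacking vertically the blocks $I_n\otimes e_{1n}^{\mathrm T},\ I_n\otimes e_{2n}^{\mathrm T},\dots,\ I_n\otimes e_{nn}^{\mathrm T}$ in this order. *)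

theory Defs
  imports "Jordan_Normal_Form.Gauss_Jordan_Elimination"
begin

text \<open>
  Matrices and vectors are those of \<^theory>\<open>Jordan_Normal_Form.Matrix\<close>, so all indices start
  at 0: \<^term>\<open>unit_vec n i\<close> is the vector written $e_{i+1,n}$ in the usual 1-based notation.
  The operator vec is called \<open>vec_stack\<close> because \<^const>\<open>Matrix.vec\<close> is the vector constructor.
\<close>

definition vec_stack :: "'a :: zero mat \<Rightarrow> 'a vec" where
  "vec_stack Y = foldr (@\<^sub>v) (cols Y) (0\<^sub>v 0)"

text \<open>
  The inverse of \<^const>\<open>vec_stack\<close> depends on the size \<open>n\<close> of the matrices; its value is meaningful
  on \<open>carrier_vec (n * n)\<close>, the image of \<open>carrier_mat n n\<close> under \<^const>\<open>vec_stack\<close>.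
\<close>

definition vec_stack_inv :: "nat \<Rightarrow> 'a :: zero vec \<Rightarrow> 'a mat" where
  "vec_stack_inv n = the_inv_into (carrier_mat n n) vec_stack"

definition kronecker :: "'a :: times mat \<Rightarrow> 'a mat \<Rightarrow> 'a mat"  (infixl \<open>\<otimes>\<^sub>m\<close> 70) where
  "A \<otimes>\<^sub>m B = mat (dim_row A * dim_row B) (dim_col A * dim_col B)
     (\<lambda>(i, j). A $$ (i div dim_row B, j div dim_col B) * B $$ (i mod dim_row B, j mod dim_col B))"

definition vec_perm_mat :: "nat \<Rightarrow> 'a :: semiring_1 mat" where
  "vec_perm_mat n =
     foldr (@\<^sub>r) (map (\<lambda>i. 1\<^sub>m n \<otimes>\<^sub>m mat_of_row (unit_vec n i)) [0..<n]) (0\<^sub>m 0 (n * n))"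

text \<open>
  \<^const>\<open>mat_inverse\<close> is option-valued; on singular matrices \<open>inv_mat\<close> is unspecified.
\<close>

definition inv_mat :: "'a :: field mat \<Rightarrow> 'a mat" where
  "inv_mat A = the (mat_inverse A)"

lemma inv_mat:
  fixes A :: "'a :: field mat"
  assumes A: "A \<in> carrier_mat n n" and inv: "invertible_mat A"
  shows "inv_mat A \<in> carrier_mat n n" "A * inv_mat A = 1\<^sub>m n" "inv_mat A * A = 1\<^sub>m n"
proof -
  from inv obtain B where B: "A * B = 1\<^sub>m (dim_row A)" "B * A = 1\<^sub>m (dim_row B)"
    unfolding invertible_mat_def inverts_mat_def by auto
  have "dim_col (A * B) = n" "dim_col (B * A) = dim_row B"
    using A B by simp_all
  hence "B \<in> carrier_mat n n" using A by auto
  hence "A \<in> Units (ring_mat TYPE('a) n ())"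
    using A B unfolding Units_def ring_mat_def by auto
  hence "mat_inverse A \<noteq> None" using mat_inverse(1)[OF A, where b = "()"] by auto
  then obtain D where "mat_inverse A = Some D" by blast
  with mat_inverse(2)[OF A this]
  show "inv_mat A \<in> carrier_mat n n" "A * inv_mat A = 1\<^sub>m n" "inv_mat A * A = 1\<^sub>m n"
    unfolding inv_mat_def by auto
qed

lemma dim_foldr_append_vec:
  "(\<And>v. v \<in> set vs \<Longrightarrow> dim_vec v = n) \<Longrightarrow> dim_vec (foldr (@\<^sub>v) vs (0\<^sub>v 0)) = length vs * n"
  by (induction vs) auto

lemma index_foldr_append_vec:
  assumes "\<And>v. v \<in> set vs \<Longrightarrow> dim_vec v = n" "j < length vs" "i < n"
  shows "foldr (@\<^sub>v) vs (0\<^sub>v 0) $ (j * n + i) = vs ! j $ i"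
  using assms
proof (induction vs arbitrary: j)
  case (Cons v vs)
  have d: "dim_vec (foldr (@\<^sub>v) vs (0\<^sub>v 0)) = length vs * n"
    using Cons.prems by (intro dim_foldr_append_vec) auto
  have "j * n + i < n + length vs * n"
  proof -
    have "j * n + n \<le> length vs * n + n"
      using mult_right_mono[of "j + 1" "length vs + 1" n] Cons.prems(2) by (simp only: add_mult_distrib) simp
    thus ?thesis using Cons.prems(3) by linarith
  qed
  with Cons d show ?case by (cases j) auto
qed auto

lemma vec_stack_carrier: "Y \<in> carrier_mat m n \<Longrightarrow> vec_stack Y \<in> carrier_vec (n * m)"
  unfolding vec_stack_def
  by (rule carrier_vecI, subst dim_foldr_append_vec[where n = m]) (auto simp: cols_def)

lemma index_vec_stack:
  assumes "Y \<in> carrier_mat m n" "i < m" "j < n"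
  shows "vec_stack Y $ (j * m + i) = Y $$ (i, j)"
  unfolding vec_stack_def using assms
  by (subst index_foldr_append_vec[where n = m]) (auto simp: cols_def)

lemma inj_on_vec_stack: "inj_on vec_stack (carrier_mat n n)"
  by (rule inj_onI, rule eq_matI) (auto simp: index_vec_stack[symmetric])

lemma vec_stack_inv: "Y \<in> carrier_mat n n \<Longrightarrow> vec_stack_inv n (vec_stack Y) = Y"
  unfolding vec_stack_inv_def by (rule the_inv_into_f_f[OF inj_on_vec_stack])

end

theory Submission
  imports Defs
begin

text \<open>
  \<^term>\<open>vec_perm_mat n\<close> permutes the entries of a stacked square matrix as transposition does, so
  $\hat Q = C - (C \hat M^T)^T$. Since $AX = \hat M B^T X = \hat M \hat X^T$, the equation reads
  $C = \hat M \hat X^T + \hat X$; substituting this into $\hat Q$ cancels the terms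
  $\hat M \hat X^T$.
\<close>

lemma foldr_append_rows_carrier:
  "(\<And>M. M \<in> set Ms \<Longrightarrow> M \<in> carrier_mat m k) \<Longrightarrow>
     foldr (@\<^sub>r) Ms (0\<^sub>m 0 k) \<in> carrier_mat (length Ms * m) k"
  by (induction Ms) (auto intro!: carrier_append_rows)

lemma index_append_rows:
  assumes "A \<in> carrier_mat m k" "B \<in> carrier_mat p k" "r < m + p" "c < k"
  shows "(A @\<^sub>r B) $$ (r, c) = (if r < m then A $$ (r, c) else B $$ (r - m, c))"
  using assms unfolding append_rows_def by (subst index_mat_four_block) auto

lemma index_foldr_append_rows:
  assumes "\<And>M. M \<in> set Ms \<Longrightarrow> M \<in> carrier_mat m k" "j < length Ms" "i < m" "c < k"
  shows "foldr (@\<^sub>r) Ms (0\<^sub>m 0 k) $$ (j * m + i, c) = Ms ! j $$ (i, c)"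
  using assms
proof (induction Ms arbitrary: j)
  case (Cons M Ms)
  have M: "M \<in> carrier_mat m k"
    using Cons.prems by simp
  have R: "foldr (@\<^sub>r) Ms (0\<^sub>m 0 k) \<in> carrier_mat (length Ms * m) k"
    using Cons.prems by (intro foldr_append_rows_carrier) auto
  \<comment> \<open>Multiplying \<open>j + 1 \<le> length Ms + 1\<close> by \<open>m\<close> leaves
    room for the offset \<open>i < m\<close>, so the index stays within the range that
    \<open>index_append_rows\<close> demands.\<close>
  have "j * m + m \<le> length Ms * m + m"
    using mult_right_mono[of "j + 1" "length Ms + 1" m] Cons.prems(2)
    by (simp only: add_mult_distrib) simp
  hence "j * m + i < m + length Ms * m"
    using Cons.prems(3) by linarith
  with Cons M R show ?case
    by (cases j) (auto simp: index_append_rows[OF M R])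
qed auto

lemma vec_perm_mat_carrier:
  "(vec_perm_mat n :: 'a :: semiring_1 mat) \<in> carrier_mat (n * n) (n * n)"
proof -
  have "(vec_perm_mat n :: 'a mat) \<in> carrier_mat
      (length (map (\<lambda>i. 1\<^sub>m n \<otimes>\<^sub>m mat_of_row (unit_vec n i)) [0..<n] :: 'a mat list) * n) (n * n)"
    unfolding vec_perm_mat_def by (rule foldr_append_rows_carrier) (auto simp: kronecker_def)
  thus ?thesis by simp
qed

text \<open>Each block has \<open>n\<close> rows, so index \<open>j * n + i\<close> means row
  \<open>i\<close> of block \<open>j\<close>. In that block the identity factor selects the column
  group \<open>i\<close>, and the unit vector selects offset \<open>j\<close> within it.\<close>

lemma row_vec_perm_mat:
  assumes "i < n" "j < n"
  shows "row (vec_perm_mat n :: 'a :: semiring_1 mat) (j * n + i) = unit_vec (n * n) (i * n + j)"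
proof (rule eq_vecI)
  have bound: "a * n + b < n * n" if "a < n" "b < n" for a b
    using that mult_right_mono[of "a + 1" n n] by simp
  fix c assume "c < dim_vec (unit_vec (n * n) (i * n + j) :: 'a vec)"
  hence c: "c < n * n" by simp
  hence n: "n > 0" using assms by simp
  have div: "c div n < n" "c mod n < n"
    using c n by (auto simp: less_mult_imp_div_less)
  have "row (vec_perm_mat n :: 'a mat) (j * n + i) $ c = vec_perm_mat n $$ (j * n + i, c)"
    using vec_perm_mat_carrier[of n, where 'a = 'a] c bound[OF assms(2,1)] by simp
  also have "\<dots> = (1\<^sub>m n \<otimes>\<^sub>m mat_of_row (unit_vec n j)) $$ (i, c)"
    unfolding vec_perm_mat_def using assms c
    by (subst index_foldr_append_rows) (auto simp: kronecker_def)
  \<comment> \<open>The right Kronecker factor is a single row of length \<open>n\<close>: the row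
    index \<open>i\<close> goes entirely to the identity factor, while \<open>c\<close> splits into
    quotient and remainder modulo \<open>n\<close>.\<close>
  also have "\<dots> = (if c div n = i \<and> c mod n = j then 1 else 0)"
    using assms c div by (auto simp: kronecker_def mat_of_row_def)
  \<comment> \<open>Division with remainder is unique because \<open>j < n\<close>.\<close>
  also have "\<dots> = (if c = i * n + j then 1 else 0)"
    using assms by auto
  finally show "row (vec_perm_mat n :: 'a mat) (j * n + i) $ c = unit_vec (n * n) (i * n + j) $ c"
    using c bound[OF assms] by simp
qed (simp add: carrier_matD[OF vec_perm_mat_carrier])

text \<open>Stacking is column by column, so entry \<open>(j, i)\<close> of \<open>Y\<close> sits at
  \<open>i * n + j\<close>, the position of the only 1 in row \<open>j * n + i\<close> of the
  permutation matrix; \<open>j * n + i\<close> is where that entry lands once \<open>Y\<close> is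
  transposed.\<close>

lemma vec_perm_mat_vec_stack:
  fixes Y :: "'a :: semiring_1 mat"
  assumes Y: "Y \<in> carrier_mat n n"
  shows "vec_perm_mat n *\<^sub>v vec_stack Y = vec_stack (Y\<^sup>T)"
proof (rule eq_vecI)
  have YT: "Y\<^sup>T \<in> carrier_mat n n" using Y by simp
  fix r assume "r < dim_vec (vec_stack (Y\<^sup>T))"
  hence r: "r < n * n" using carrier_vecD[OF vec_stack_carrier[OF YT]] by simp
  define i j where "i = r mod n" and "j = r div n"
  have ij: "i < n" "j < n" and r_eq: "r = j * n + i"
    \<comment> \<open>For \<open>n = 0\<close> the bound on \<open>r\<close> is already
      contradictory; otherwise \<open>r mod n < n\<close>.\<close>
    using r by (cases "n = 0"; simp add: i_def j_def less_mult_imp_div_less)+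
  have c: "i * n + j < n * n"
    using ij mult_right_mono[of "i + 1" n n] by simp
  have "(vec_perm_mat n *\<^sub>v vec_stack Y) $ r = unit_vec (n * n) (i * n + j) \<bullet> vec_stack Y"
    using r row_vec_perm_mat[OF ij, where 'a = 'a] carrier_matD[OF vec_perm_mat_carrier[of n, where 'a = 'a]]
    by (simp add: r_eq)
  also have "\<dots> = vec_stack Y $ (i * n + j)"
    using vec_stack_carrier[OF Y] c by (rule scalar_prod_left_unit)
  also have "\<dots> = vec_stack (Y\<^sup>T) $ r"
    using ij Y by (simp add: r_eq index_vec_stack[OF Y] index_vec_stack[OF YT])
  finally show "(vec_perm_mat n *\<^sub>v vec_stack Y) $ r = vec_stack (Y\<^sup>T) $ r" .
next
  have "Y\<^sup>T \<in> carrier_mat n n" using Y by simp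
  from vec_stack_carrier[OF this]
  show "dim_vec (vec_perm_mat n *\<^sub>v vec_stack Y) = dim_vec (vec_stack (Y\<^sup>T))"
    using vec_perm_mat_carrier[of n, where 'a = 'a] by simp
qed

text \<open>The transposed inverse inverts the transpose. This is needed because
  \<open>inv_mat (B\<^sup>T)\<close> is specified only when its argument is invertible.\<close>

lemma invertible_mat_transpose:
  fixes B :: "'a :: field mat"
  assumes B: "B \<in> carrier_mat n n" and inv: "invertible_mat B"
  shows "invertible_mat (B\<^sup>T)"
proof -
  note D = inv_mat[OF B inv]
  have "B\<^sup>T * (inv_mat B)\<^sup>T = 1\<^sub>m n" "(inv_mat B)\<^sup>T * B\<^sup>T = 1\<^sub>m n"
    using transpose_mult[OF D(1) B, symmetric] transpose_mult[OF B D(1), symmetric]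
    unfolding D(2,3) by simp_all
  thus ?thesis
    using B D(1) unfolding invertible_mat_def inverts_mat_def by auto
qed

theorem corollary3p2:
  fixes n :: nat and A B C X X_hat M_hat Q_hat :: "real mat"
  assumes "A \<in> carrier_mat n n" and "B \<in> carrier_mat n n"
    and "C \<in> carrier_mat n n" and "X \<in> carrier_mat n n"
    and "invertible_mat B"
    and "X_hat = X\<^sup>T * B"
    and "M_hat = A * inv_mat (B\<^sup>T)"
    and "Q_hat = C - vec_stack_inv n (vec_perm_mat n *\<^sub>v vec_stack (C * M_hat\<^sup>T))"
    and "A * X + X\<^sup>T * B = C"
  shows "X_hat - M_hat * X_hat * M_hat\<^sup>T = Q_hat"
proof -
  note A = assms(1) and B = assms(2) and C = assms(3) and X = assms(4)
  have BT: "B\<^sup>T \<in> carrier_mat n n" using B by simp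
  note D = inv_mat[OF BT invertible_mat_transpose[OF B assms(5)]]
  have M: "M_hat \<in> carrier_mat n n" using A D(1) assms(7) by simp
  have H: "X_hat \<in> carrier_mat n n" using X B assms(6) by simp
  have HT: "X_hat\<^sup>T = B\<^sup>T * X"
    using transpose_mult[of "X\<^sup>T" n n B n] X B assms(6) by simp
  \<comment> \<open>The inverse inside \<open>M_hat\<close> meets the factor
    \<open>B\<^sup>T\<close> of \<open>X_hat\<^sup>T\<close> and cancels, leaving
    \<open>A * X\<close>.\<close>
  have "M_hat * X_hat\<^sup>T = A * (inv_mat (B\<^sup>T) * (B\<^sup>T * X))"
    unfolding HT assms(7) using A D(1) BT X by (intro assoc_mult_mat) auto
  also have "inv_mat (B\<^sup>T) * (B\<^sup>T * X) = X"
    using assoc_mult_mat[OF D(1) BT X] D(3) X by simp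
  finally have C_eq: "C = M_hat * X_hat\<^sup>T + X_hat"
    using assms(6,9) by simp
  have "(C * M_hat\<^sup>T)\<^sup>T = M_hat * C\<^sup>T"
    using transpose_mult[of C n n "M_hat\<^sup>T" n] C M by simp
  also have "C\<^sup>T = X_hat * M_hat\<^sup>T + X_hat\<^sup>T"
    unfolding C_eq using transpose_add[of "M_hat * X_hat\<^sup>T" n n X_hat]
      transpose_mult[of M_hat n n "X_hat\<^sup>T" n] M H by simp
  also have "M_hat * \<dots> = M_hat * (X_hat * M_hat\<^sup>T) + M_hat * X_hat\<^sup>T"
    using M H by (intro mult_add_distrib_mat) auto
  also have "M_hat * (X_hat * M_hat\<^sup>T) = M_hat * X_hat * M_hat\<^sup>T"
    using M H by (intro assoc_mult_mat[symmetric]) auto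
  finally have T: "(C * M_hat\<^sup>T)\<^sup>T = M_hat * X_hat * M_hat\<^sup>T + M_hat * X_hat\<^sup>T" .
  have "Q_hat = C - (C * M_hat\<^sup>T)\<^sup>T"
    using C M by (simp add: assms(8) vec_perm_mat_vec_stack vec_stack_inv)
  also have "\<dots> = X_hat - M_hat * X_hat * M_hat\<^sup>T"
  proof -
    \<comment> \<open>What remains is \<open>(U + X_hat) - (V + U) = X_hat - V\<close>, checked
      entrywise. Naming the products keeps their entries from being expanded into scalar products.
      \<open>T\<close> is unfolded before \<open>C_eq\<close> because its left-hand side contains
      \<open>C\<close>.\<close>
    define U V where "U = M_hat * X_hat\<^sup>T" and "V = M_hat * X_hat * M_hat\<^sup>T"
    have "U \<in> carrier_mat n n" "V \<in> carrier_mat n n"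
      using M H by (auto simp: U_def V_def)
    thus ?thesis
      unfolding T unfolding C_eq U_def[symmetric] V_def[symmetric] using H by (intro eq_matI) auto
  qed
  finally show ?thesis by simp
qed

end
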